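(* Let $\|\cdot\|$ be a unitarily invariant norm on $\mathcal{M}_n(\mathbb{F})$, and suppose that $(X,\|\cdot\|)$ is an admissible matrix space in $\mathcal{M}_n(\mathbb{F})$. If $\eta\in\mathcal{T}(X,\|\cdot\|)$, then there exist unique matrices $a,b,c\in\mathcal{M}_n(\mathbb{F})$ with $a\in\mathrm{Skew}_n(\mathbb{F})$, $b\in\mathrm{Skew}_n^0(\mathbb{F})$ and $c\in X$ such that $$\eta(x)=ax+xb+c\qquad\text{for all }x\in X.$$
   Context: Throughout, $n\ge 2$ is an integer, $\mathbb{F}\in\{\mathbb{R},\mathbb{C}\}$, and $\mathcal{M}_n(\mathbb{F})$ is the algebra of $n\times n$ matrices over $\mathbb{F}$; $a^*$ is the conjugate transpose of $a$ (the transpose if $\mathbb{F}=\mathbb{R}$), $I$ is the identity matrix, $e_{ij}$ are the matrix units. $\mathcal{U}_n(\mathbb{F})$ is the set of unitary (orthogonal, if $\mathbb{F}=\mathbb{R}$) matrices. $\mathrm{Skew}_n(\mathbb{F})$ is the set of skew-hermitian ($a^*=-a$) matrices in $\mathcal{M}_n(\mathbb{F})$ and $\mathrm{Skew}_n^0(\mathbb{F})$ is the set of those with zero $(1,1)$ entry. A norm on $\mathcal{M}_n(\mathbb{F})$ is unitarily invariant if $\|a\|=\|uaw\|$ for all $a\in\mathcal{M}_n(\mathbb{F})$ and $u,w\in\mathcal{U}_n(\mathbb{F})$. A test set on $\mathcal{M}_n(\mathbb{F})$ is a finite set $\Gamma$ of real-linear maps $\mathcal{M}_n(\mathbb{F})\to\mathcal{M}_n(\mathbb{F})$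 containing the identity map and with $\gamma(I)=I$ for all $\gamma\in\Gamma$. For a real-linear subspace $X\subseteq\mathcal{M}_n(\mathbb{F})$, put $X^\gamma=\{y\in\mathcal{M}_n(\mathbb{F}): xy=y\gamma(x)\ \forall x\in X\}$ and $X^\Gamma=\bigcup_{\gamma\in\Gamma}X^\gamma$. $X$ is $\Gamma$-large in $\mathcal{M}_n(\mathbb{F})$ if $I\in X$ and $X^\Gamma=\mathbb{F}I$. For a unitarily invariant norm, $(X,\|\cdot\|)$ has the $\Gamma$-isometry property if every real-linear isometry $A:X\to X$ has the form $A(x)=u\,\gamma(x)\,w$ $(x\in X)$ for some $u,w\in\mathcal{U}_n(\mathbb{F})$ and $\gamma\in\Gamma$. $(X,\|\cdot\|)$, with $X$ a real-linear subspace of $\mathcal{M}_n(\mathbb{F})$ and $\|\cdot\|$ a unitarily invariant norm on $\mathcal{M}_n(\mathbb{F})$, is an admissible matrix space (in $\mathcal{M}_n(\mathbb{F})$) if: (a) there is a test set $\Gamma$ such that $X$ is $\Gamma$-large and $(X,\|\cdot\|)$ has the $\Gamma$-isometry property; (b) there exist scalars $\lambda_i\in\mathbb{F}$, $1\le i\le n$, such that $e_{ii}\in X$ and $e_{1i}+\lambda_i e_{i1}\in X$; (c) $x^*\in X$ for every $x\in X$. A rigid motion of a normed space $(X,\|\cdot\|)$ is a family of continuous paths $\alpha=\{\alpha_x:[-1,1]\to X\}_{x\in X}$ with $\alpha_x(0)=x$, $\alpha_x$ differentiable at $t=0$ for all $x\in X$, and $\|\alpha_x(t)-\alpha_y(t)\|=\|x-y\|$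 for all $x,y\in X$, $t\in[-1,1]$. An infinitesimal rigid motion is a map $\eta:X\to X$ of the form $\eta(x)=\alpha_x'(0)$ for some rigid motion $\alpha$; $\mathcal{T}(X,\|\cdot\|)$ denotes the real-linear space of all infinitesimal rigid motions. *)

theory Defs
  imports "HOL-Analysis.Analysis"
begin

section \<open>The scalar field\<close>

text \<open>
  The class captures exactly the fields \<open>\<real>\<close> and \<open>\<complex>\<close> with their usual conjugation
  (the identity on \<open>\<real>\<close>), see \<open>real_or_complex_cases\<close> below.
\<close>

class real_or_complex = real_normed_field + euclidean_space +
  fixes conjg :: "'a \<Rightarrow> 'a"
  assumes conjg_add: "conjg (x + y) = conjg x + conjg y"
    and mult_conjg_scaleR: "x * conjg x = (norm x)\<^sup>2 *\<^sub>R 1"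

instantiation real :: real_or_complex
begin
definition conjg_real :: "real \<Rightarrow> real" where "conjg_real x = x"
instance by standard (simp_all add: conjg_real_def power2_eq_square)
end

instantiation complex :: real_or_complex
begin
definition conjg_complex :: "complex \<Rightarrow> complex" where "conjg_complex z = cnj z"
instance
  by standard
    (simp_all add: conjg_complex_def scaleR_conv_of_real complex_norm_square del: of_real_power)
end

lemma mult_conjg: "x * conjg x = of_real ((norm (x::'a::real_or_complex))\<^sup>2)"
  unfolding of_real_def by (rule mult_conjg_scaleR)

lemma norm_conjg: "norm (conjg x) = norm (x::'a::real_or_complex)"
proof (cases "x = 0")
  case True
  have "conjg (0::'a) = 0" using conjg_add[of "0::'a" 0] by simp
  with True show ?thesis by simp
next
  case False
  have "norm x * norm (conjg x) = (norm x)\<^sup>2"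
    by (metis mult_conjg norm_mult norm_of_real abs_power2)
  with False show ?thesis by (simp add: power2_eq_square)
qed

lemma conjg_conjg: "conjg (conjg x) = (x::'a::real_or_complex)"
proof (cases "x = 0")
  case True
  have "conjg (0::'a) = 0" using conjg_add[of "0::'a" 0] by simp
  with True show ?thesis by simp
next
  case False
  have "conjg x * conjg (conjg x) = conjg x * x"
    by (metis mult_conjg norm_conjg mult.commute)
  moreover have "conjg x \<noteq> 0" using False norm_conjg[of x] by auto
  ultimately show ?thesis by simp
qed

lemma conjg_of_real: "conjg (of_real r :: 'a::real_or_complex) = of_real r"
proof (cases "r = 0")
  case True
  have "conjg (0::'a) = 0" using conjg_add[of "0::'a" 0] by simp
  with True show ?thesis by simp
next
  case False
  have "of_real r * conjg (of_real r :: 'a) = of_real r * of_real r"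
    by (simp add: mult_conjg power2_eq_square flip: of_real_mult)
  with False show ?thesis by simp
qed

lemma conjg_mult: "conjg (x * y) = conjg x * conjg (y::'a::real_or_complex)"
proof (cases "x = 0 \<or> y = 0")
  case True
  have "conjg (0::'a) = 0" using conjg_add[of "0::'a" 0] by simp
  with True show ?thesis by auto
next
  case False
  have "(x * y) * conjg (x * y) = (x * conjg x) * (y * conjg y)"
    unfolding mult_conjg by (simp add: norm_mult power_mult_distrib)
  then have "(x * y) * conjg (x * y) = (x * y) * (conjg x * conjg y)"
    by (simp add: mult_ac)
  with False show ?thesis by simp
qed

lemma add_conjg_Reals: "x + conjg x \<in> (\<real> :: 'a::real_or_complex set)"
proof -
  have "(1 + x) * conjg (1 + x) = 1 + (x + conjg x) + x * conjg x"
    using conjg_of_real[of 1, where 'a='a] by (simp add: conjg_add algebra_simps)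
  then have "x + conjg x = of_real ((norm (1 + x))\<^sup>2 - 1 - (norm x)\<^sup>2)"
    unfolding mult_conjg by (simp add: algebra_simps)
  then show ?thesis by (metis Reals_of_real)
qed

lemma conjg_fixed_Reals: "conjg x = x \<Longrightarrow> x \<in> (\<real> :: 'a::real_or_complex set)"
proof -
  assume "conjg x = x"
  then have "x = (x + conjg x) / of_real 2" by simp
  then show ?thesis by (metis add_conjg_Reals Reals_divide Reals_of_real)
qed

lemma real_or_complex_cases:
  "(\<forall>x::'a::real_or_complex. x \<in> \<real> \<and> conjg x = x) \<or>
   (\<exists>i::'a. i * i = -1 \<and> conjg i = -i \<and> (\<forall>x. \<exists>r s. x = of_real r + of_real s * i))"
proof (cases "\<forall>x::'a. conjg x = x")
  case True
  then show ?thesis using conjg_fixed_Reals by blast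
next
  case False
  then obtain x :: 'a where x: "conjg x \<noteq> x" by blast
  define y where "y = x - conjg x"
  have minus: "conjg (- z) = - conjg z" for z :: 'a
  proof -
    have "conjg (0::'a) = 0" using conjg_add[of "0::'a" 0] by simp
    then show ?thesis using conjg_add[of z "- z"] by (simp add: add_eq_0_iff)
  qed
  have y: "conjg y = - y" "y \<noteq> 0"
    using x conjg_add[of x "- conjg x"] by (simp_all add: y_def minus conjg_conjg)
  define i where "i = y * of_real (inverse (norm y))"
  have ci: "conjg i = - i"
    unfolding i_def conjg_mult conjg_of_real y by simp
  have "norm i = 1" using y by (simp add: i_def norm_mult norm_inverse)
  then have ii: "i * i = -1"
    using mult_conjg[of i] by (simp add: ci minus_equation_iff)
  have "\<exists>r s. z = of_real r + of_real s * i" for z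
  proof -
    define p where "p = (z + conjg z) / of_real 2"
    define q where "q = i * (conjg z - z) / of_real 2"
    have "conjg (conjg z - z) = z - conjg z"
      using conjg_add[of "conjg z" "- z"] by (simp add: minus conjg_conjg)
    then have "conjg (i * (conjg z - z)) = i * (conjg z - z)"
      unfolding conjg_mult ci by (simp only: minus_mult_left[symmetric] minus_mult_right minus_diff_eq)
    then have "q \<in> \<real>" "p \<in> \<real>"
      unfolding p_def q_def by (metis conjg_fixed_Reals Reals_divide Reals_of_real,
          metis add_conjg_Reals Reals_divide Reals_of_real)
    moreover have "q * i = (i * i) * (conjg z - z) / of_real 2"
      by (simp add: q_def)
    then have "z = p + q * i" unfolding ii p_def by (simp add: field_simps)
    ultimately show ?thesis by (metis Reals_cases)
  qed
  with ii ci show ?thesis by blast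
qed


section \<open>Matrices\<close>

definition adj :: "'f::real_or_complex^'n^'n \<Rightarrow> 'f^'n^'n" where
  "adj a = (\<chi> i j. conjg (a $ j $ i))"

definition unitary :: "('f::real_or_complex^'n^'n) set" where
  "unitary = {u. adj u ** u = mat 1 \<and> u ** adj u = mat 1}"

definition munit :: "'n \<Rightarrow> 'n \<Rightarrow> 'f::real_or_complex^'n^'n" where
  "munit i j = (\<chi> r s. if r = i \<and> s = j then 1 else 0)"

definition skew :: "('f::real_or_complex^'n^'n) set" where
  "skew = {a. adj a = - a}"

text \<open>
  Rows and columns are indexed by an arbitrary finite type; the parameter \<open>\<iota>\<close> below is
  the element of that type playing the role of the index \<open>1\<close>.
\<close>

definition skew0 :: "'n \<Rightarrow> ('f::real_or_complex^'n^'n) set" where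
  "skew0 \<iota> = {a \<in> skew. a $ \<iota> $ \<iota> = 0}"

text \<open>Scalar multiplication by \<open>k\<close> is multiplication by the scalar matrix \<open>mat k\<close>.\<close>

definition matrix_norm :: "('f::real_or_complex^'n^'n \<Rightarrow> real) \<Rightarrow> bool" where
  "matrix_norm N \<longleftrightarrow>
     (\<forall>a. 0 \<le> N a) \<and> (\<forall>a. N a = 0 \<longleftrightarrow> a = 0) \<and>
     (\<forall>k a. N (mat k ** a) = norm k * N a) \<and> (\<forall>a b. N (a + b) \<le> N a + N b)"

definition unitarily_invariant_norm :: "('f::real_or_complex^'n^'n \<Rightarrow> real) \<Rightarrow> bool" where
  "unitarily_invariant_norm N \<longleftrightarrow>
     matrix_norm N \<and> (\<forall>a. \<forall>u\<in>unitary. \<forall>w\<in>unitary. N (u ** a ** w) = N a)"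


section \<open>Admissible matrix spaces\<close>

text \<open>
  \<open>linear\<close> and \<open>subspace\<close> are the real-linear notions, also when the scalar field is complex.
\<close>

definition test_set :: "('f::real_or_complex^'n^'n \<Rightarrow> 'f^'n^'n) set \<Rightarrow> bool" where
  "test_set \<Gamma> \<longleftrightarrow> finite \<Gamma> \<and> id \<in> \<Gamma> \<and> (\<forall>\<gamma>\<in>\<Gamma>. linear \<gamma> \<and> \<gamma> (mat 1) = mat 1)"

definition twisted_commutant ::
    "('f::real_or_complex^'n^'n) set \<Rightarrow> ('f^'n^'n \<Rightarrow> 'f^'n^'n) \<Rightarrow> ('f^'n^'n) set" where
  "twisted_commutant X \<gamma> = {y. \<forall>x\<in>X. x ** y = y ** \<gamma> x}"

definition large ::
    "('f::real_or_complex^'n^'n \<Rightarrow> 'f^'n^'n) set \<Rightarrow> ('f^'n^'n) set \<Rightarrow> bool" where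
  "large \<Gamma> X \<longleftrightarrow> mat 1 \<in> X \<and> (\<Union>\<gamma>\<in>\<Gamma>. twisted_commutant X \<gamma>) = range mat"

definition real_linear_isometry ::
    "('f::real_or_complex^'n^'n) set \<Rightarrow> ('f^'n^'n \<Rightarrow> real) \<Rightarrow> ('f^'n^'n \<Rightarrow> 'f^'n^'n) \<Rightarrow> bool" where
  "real_linear_isometry X N A \<longleftrightarrow>
     (\<forall>x\<in>X. A x \<in> X) \<and> (\<forall>x\<in>X. \<forall>y\<in>X. A (x + y) = A x + A y) \<and>
     (\<forall>r. \<forall>x\<in>X. A (r *\<^sub>R x) = r *\<^sub>R A x) \<and> (\<forall>x\<in>X. N (A x) = N x)"

definition isometry_property ::
    "('f::real_or_complex^'n^'n \<Rightarrow> 'f^'n^'n) set \<Rightarrow> ('f^'n^'n) set \<Rightarrow> ('f^'n^'n \<Rightarrow> real) \<Rightarrow> bool" where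
  "isometry_property \<Gamma> X N \<longleftrightarrow>
     (\<forall>A. real_linear_isometry X N A \<longrightarrow>
        (\<exists>u\<in>unitary. \<exists>w\<in>unitary. \<exists>\<gamma>\<in>\<Gamma>. \<forall>x\<in>X. A x = u ** \<gamma> x ** w))"

definition admissible ::
    "'n \<Rightarrow> ('f::real_or_complex^'n^'n) set \<Rightarrow> ('f^'n^'n \<Rightarrow> real) \<Rightarrow> bool" where
  "admissible \<iota> X N \<longleftrightarrow>
     subspace X \<and> unitarily_invariant_norm N \<and>
     (\<exists>\<Gamma>. test_set \<Gamma> \<and> large \<Gamma> X \<and> isometry_property \<Gamma> X N) \<and>
     (\<exists>l :: 'n \<Rightarrow> 'f. \<forall>i. munit i i \<in> X \<and> munit \<iota> i + mat (l i) ** munit i \<iota> \<in> X) \<and>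
     (\<forall>x\<in>X. adj x \<in> X)"


section \<open>Rigid motions\<close>

text \<open>
  Continuity and differentiability are taken with respect to the given norm \<open>N\<close> rather than
  the type-class norm on \<open>'f^'n^'n\<close>. Paths are total functions on \<open>real\<close>, but only
  their values on \<open>{-1..1}\<close> matter.
\<close>

definition N_path ::
    "('f::real_or_complex^'n^'n) set \<Rightarrow> ('f^'n^'n \<Rightarrow> real) \<Rightarrow> (real \<Rightarrow> 'f^'n^'n) \<Rightarrow> bool" where
  "N_path X N p \<longleftrightarrow>
     (\<forall>t\<in>{-1..1}. p t \<in> X \<and> ((\<lambda>s. N (p s - p t)) \<longlongrightarrow> 0) (at t within {-1..1}))"

definition has_N_derivative_at_0 ::
    "('f::real_or_complex^'n^'n \<Rightarrow> real) \<Rightarrow> (real \<Rightarrow> 'f^'n^'n) \<Rightarrow> 'f^'n^'n \<Rightarrow> bool" where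
  "has_N_derivative_at_0 N p v \<longleftrightarrow>
     ((\<lambda>t. N ((1 / t) *\<^sub>R (p t - p 0) - v)) \<longlongrightarrow> 0) (at 0)"

definition rigid_motion ::
    "('f::real_or_complex^'n^'n) set \<Rightarrow> ('f^'n^'n \<Rightarrow> real) \<Rightarrow>
     ('f^'n^'n \<Rightarrow> real \<Rightarrow> 'f^'n^'n) \<Rightarrow> bool" where
  "rigid_motion X N \<alpha> \<longleftrightarrow>
     (\<forall>x\<in>X. N_path X N (\<alpha> x) \<and> \<alpha> x 0 = x \<and> (\<exists>v\<in>X. has_N_derivative_at_0 N (\<alpha> x) v)) \<and>
     (\<forall>x\<in>X. \<forall>y\<in>X. \<forall>t\<in>{-1..1}. N (\<alpha> x t - \<alpha> y t) = N (x - y))"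

text \<open>
  Maps \<open>X \<rightarrow> X\<close> are represented by total functions; their values outside \<open>X\<close> are irrelevant.
\<close>

definition infinitesimal_rigid_motions ::
    "('f::real_or_complex^'n^'n) set \<Rightarrow> ('f^'n^'n \<Rightarrow> real) \<Rightarrow> ('f^'n^'n \<Rightarrow> 'f^'n^'n) set" where
  "infinitesimal_rigid_motions X N =
     {\<eta>. \<exists>\<alpha>. rigid_motion X N \<alpha> \<and>
          (\<forall>x\<in>X. \<eta> x \<in> X \<and> has_N_derivative_at_0 N (\<alpha> x) (\<eta> x))}"

end

theory Submission
  imports Defs
begin

text \<open>
  Let \<open>\<alpha>\<close> be a rigid motion with velocity field \<open>\<eta>\<close>. At each time \<open>t\<close> the map
  \<open>x \<mapsto> \<alpha> x t - \<alpha> 0 t\<close> is an isometry of the finite-dimensional normed space \<open>X\<close> into itself which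
  fixes \<open>0\<close>. Compactness makes it onto (\<open>isometric_onto\<close>), and the Mazur--Ulam theorem then makes
  it real-linear. So the isometry property applies: along the times \<open>1 / (k + 1)\<close> one has linear
  isometries \<open>A k\<close> of \<open>X\<close> of the form \<open>x \<mapsto> u \<gamma>(x) w\<close> with \<open>u\<close>, \<open>w\<close> unitary, which converge to the
  identity, and whose difference quotients converge to \<open>D x = \<eta> x - \<eta> 0\<close>.

  The test set is finite and the unitary matrices are bounded, so along a subsequence \<open>\<gamma>\<close> is
  constant and \<open>w\<close> converges, to \<open>w0\<close> say. With \<open>v = A(I) = u w\<close> the isometries read
  \<open>x \<mapsto> v w* \<gamma>(x) w\<close>, where \<open>v\<close> tends to \<open>I\<close>. In the limit \<open>x = w0* \<gamma>(x) w0\<close>, so \<open>w0*\<close> lies in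
  \<open>X\<^sup>\<gamma>\<close>, which by largeness consists of scalars. Hence \<open>w0\<close> is scalar and \<open>\<gamma>\<close> is the identity on
  \<open>X\<close>: the test set has disappeared from the problem.

  What remains is to differentiate \<open>x \<mapsto> v w* x w\<close> at the identity. The factor \<open>v\<close> contributes
  \<open>D(I) x\<close>, and \<open>D(I)\<close> is skew because \<open>v\<close> is unitary (\<open>skew_derivative\<close>). Nothing is known about
  the derivative of \<open>w\<close> itself, and indeed \<open>w\<close> matters only up to scalars; but the commutators of
  \<open>x\<close> with the difference quotients of \<open>w\<close> converge for each \<open>x\<close> in \<open>X\<close>. Since only scalars commute
  with all of \<open>X\<close>, the limit is again a commutator \<open>x b - b x\<close> with a fixed \<open>b\<close>
  (\<open>commutator_limit\<close>), and as \<open>X\<close> is closed under adjoints, \<open>b\<close> can be made skew with vanishing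
  \<open>(\<iota>, \<iota>)\<close> entry by subtracting a scalar (\<open>skew_commutator\<close>). This yields
  \<open>D x = (D(I) - b) x + x b\<close>.

  For uniqueness, evaluating at \<open>0\<close> and at \<open>I\<close> leaves only the possibility of changing \<open>b\<close> by a
  matrix commuting with \<open>X\<close>, that is by a scalar, and the condition on the \<open>(\<iota>, \<iota>)\<close> entry fixes it.
\<close>

section \<open>Isometries of normed spaces and the Mazur--Ulam theorem\<close>

text \<open>
  The norm \<open>N\<close> lives on the ambient space, independently of any type-class norm there, while
  isometries are considered only on the subspace \<open>E\<close>.
\<close>

locale normed_subspace =
  fixes E :: "'a::real_vector set" and N :: "'a \<Rightarrow> real"
  assumes subspace_E: "subspace E"
    and N_triangle: "N (x + y) \<le> N x + N y"
    and N_scaleR: "N (r *\<^sub>R x) = \<bar>r\<bar> * N x"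
    and N_eq_0: "N x = 0 \<Longrightarrow> x = 0"
begin

lemma N_zero [simp]: "N 0 = 0"
  using N_scaleR[of 0 0] by simp

lemma N_minus: "N (- x) = N x"
  using N_scaleR[of "-1" x] by simp

lemma N_nonneg [simp]: "0 \<le> N x"
  using N_triangle[of x "- x"] by (simp add: N_minus)

lemma N_pos: "x \<noteq> 0 \<Longrightarrow> 0 < N x"
  using N_eq_0[of x] N_nonneg[of x] by linarith

lemma N_commute: "N (x - y) = N (y - x)"
  using N_minus[of "x - y"] by simp

lemma N_triangle_diff: "N (x - z) \<le> N (x - y) + N (y - z)"
  using N_triangle[of "x - y" "y - z"] by simp

definition isometric :: "('a \<Rightarrow> 'a) \<Rightarrow> bool" where
  "isometric f \<longleftrightarrow> f ` E \<subseteq> E \<and> (\<forall>x\<in>E. \<forall>y\<in>E. N (f x - f y) = N (x - y))"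

lemma isometric_inj_on: "isometric f \<Longrightarrow> inj_on f E"
  unfolding isometric_def inj_on_def by (metis N_eq_0 N_zero diff_self eq_iff_diff_eq_0)

lemma onto_isometry_inv_into:
  assumes "isometric f" "f ` E = E"
  shows "isometric (inv_into E f)" "inv_into E f ` E = E"
proof -
  have "N (inv_into E f x - inv_into E f y) = N (x - y)" if "x \<in> E" "y \<in> E" for x y
    using assms that inv_into_into[of _ f E] f_inv_into_f[of _ f E]
    unfolding isometric_def by metis
  moreover show "inv_into E f ` E = E"
    using assms by (metis bij_betw_imp_surj_on bij_betw_inv_into isometric_inj_on bij_betw_def)
  ultimately show "isometric (inv_into E f)"
    by (simp add: isometric_def)
qed

lemma isometric_comp: "isometric f \<Longrightarrow> isometric g \<Longrightarrow> isometric (f \<circ> g)"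
  unfolding isometric_def by (force simp: image_subset_iff)

lemma onto_comp: "f ` E = E \<Longrightarrow> g ` E = E \<Longrightarrow> (f \<circ> g) ` E = E"
  by (metis image_comp)

lemma isometric_reflection:
  assumes "z \<in> E"
  shows "isometric (\<lambda>x. 2 *\<^sub>R z - x)" "(\<lambda>x. 2 *\<^sub>R z - x) ` E = E"
proof -
  have in_E: "2 *\<^sub>R z - x \<in> E" if "x \<in> E" for x
    using assms that subspace_E by (simp add: subspace_diff subspace_scale)
  then show "isometric (\<lambda>x. 2 *\<^sub>R z - x)"
    by (auto simp: isometric_def N_commute)
  show "(\<lambda>x. 2 *\<^sub>R z - x) ` E = E"
    using in_E by (auto intro!: image_eqI[of _ _ "2 *\<^sub>R z - _"])
qed

text \<open>
  The core of Vaisala's proof of the Mazur--Ulam theorem. Conjugating \<open>g\<^sup>-\<^sup>1\<close> by the point reflection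
  in the midpoint \<open>z\<close> and composing with \<open>g\<close> gives another isometry fixing \<open>a\<close> and \<open>b\<close> which
  moves \<open>z\<close> exactly twice as far. No such isometry moves \<open>z\<close> farther than \<open>2 * N (z - a)\<close>, since
  it keeps the distance of \<open>z\<close> from the fixed point \<open>a\<close>; iterating the doubling therefore gives the
  exponentially improving bound.
\<close>

lemma onto_isometry_fixes_midpoint_bound:
  assumes "a \<in> E" "b \<in> E" "z = (1/2) *\<^sub>R (a + b)"
    and "isometric g" "g ` E = E" "g a = a" "g b = b"
  shows "2 ^ n * N (g z - z) \<le> 2 * N (z - a)"
  using assms(4-)
proof (induction n arbitrary: g)
  case 0
  have "z \<in> E" using assms(1-3) subspace_E by (simp add: subspace_add subspace_scale)
  then have "N (g z - g a) = N (z - a)"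
    using 0(1) assms(1) unfolding isometric_def by blast
  then show ?case
    using N_triangle_diff[of "g z" z a] 0 N_commute[of a z] by simp
next
  case (Suc n)
  have zE: "z \<in> E" using assms(1-3) subspace_E by (simp add: subspace_add subspace_scale)
  have zz: "2 *\<^sub>R z = a + b" using assms(3) by simp
  define refl where "refl x = 2 *\<^sub>R z - x" for x
  define h where "h = refl \<circ> (inv_into E g \<circ> (refl \<circ> g))"
  have refl: "isometric refl" "refl ` E = E"
    unfolding refl_def using isometric_reflection[OF zE] by simp_all
  note inv = onto_isometry_inv_into[OF Suc.prems(1,2)]
  have inj: "inj_on g E" using Suc.prems(1) by (rule isometric_inj_on)
  have fixed: "inv_into E g a = a" "inv_into E g b = b"
    using inv_into_f_f[OF inj] assms(1,2) Suc.prems(3,4) by metis+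
  have "isometric h" "h ` E = E"
    unfolding h_def by (intro isometric_comp onto_comp refl inv Suc.prems(1,2))+
  moreover have "h a = a" "h b = b"
    using fixed Suc.prems(3,4) zz by (simp_all add: h_def refl_def)
  ultimately have IH: "2 ^ n * N (h z - z) \<le> 2 * N (z - a)" by (rule Suc.IH)
  have gz: "g z \<in> E" using Suc.prems(2) zE by blast
  then have rgz: "refl (g z) \<in> E" using refl(2) by blast
  have "N (h z - z) = N (z - inv_into E g (refl (g z)))"
    by (simp add: h_def refl_def scaleR_2)
  also have "\<dots> = N (g z - g (inv_into E g (refl (g z))))"
    using Suc.prems(1,2) zE inv_into_into[of _ g E] rgz by (simp add: isometric_def)
  also have "g (inv_into E g (refl (g z))) = refl (g z)"
    using Suc.prems(2) rgz by (simp add: f_inv_into_f)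
  also have "g z - refl (g z) = 2 *\<^sub>R (g z - z)"
    by (simp add: refl_def algebra_simps scaleR_2)
  also have "N \<dots> = 2 * N (g z - z)" by (simp add: N_scaleR)
  finally show ?case using IH by simp
qed

lemma onto_isometry_fixes_midpoint:
  assumes "a \<in> E" "b \<in> E" "z = (1/2) *\<^sub>R (a + b)"
    and "isometric g" "g ` E = E" "g a = a" "g b = b"
  shows "g z = z"
proof (rule ccontr)
  assume "g z \<noteq> z"
  then have pos: "N (g z - z) > 0" using N_pos[of "g z - z"] by simp
  obtain n where "2 * N (z - a) / N (g z - z) < 2 ^ n"
    using real_arch_pow[of 2] by auto
  then show False
    using onto_isometry_fixes_midpoint_bound[OF assms, of n] pos by (simp add: field_simps)
qed

text \<open>
  The map \<open>h\<close>, which is \<open>f\<close> followed by the reflection in the midpoint \<open>z'\<close> of the images, by the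
  inverse of \<open>f\<close> and by the reflection in the midpoint \<open>z\<close>, fixes \<open>a\<close> and \<open>b\<close>. Hence it fixes \<open>z\<close>,
  which says that \<open>f z\<close> is a fixed point of the reflection in \<open>z'\<close>, that is, \<open>f z = z'\<close>.
\<close>

lemma onto_isometry_midpoint:
  assumes "isometric f" "f ` E = E" "a \<in> E" "b \<in> E"
  shows "f ((1/2) *\<^sub>R (a + b)) = (1/2) *\<^sub>R (f a + f b)"
proof -
  define z where "z = (1/2) *\<^sub>R (a + b)"
  define z' where "z' = (1/2) *\<^sub>R (f a + f b)"
  have fE: "f a \<in> E" "f b \<in> E" using assms by auto
  have zE: "z \<in> E" "z' \<in> E"
    using assms(3,4) fE subspace_E by (simp_all add: z_def z'_def subspace_add subspace_scale)
  define h where "h = (\<lambda>x. 2 *\<^sub>R z - x) \<circ> (inv_into E f \<circ> ((\<lambda>x. 2 *\<^sub>R z' - x) \<circ> f))"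
  have inj: "inj_on f E" using assms(1) by (rule isometric_inj_on)
  note inv = onto_isometry_inv_into[OF assms(1,2)]
  have "isometric h" "h ` E = E"
    unfolding h_def
    by (intro isometric_comp onto_comp isometric_reflection zE inv assms(1,2))+
  moreover have "h a = a" "h b = b"
    using inj assms(3,4) by (simp_all add: h_def z_def z'_def)
  ultimately have "h z = z"
    using onto_isometry_fixes_midpoint[OF assms(3,4) z_def] by blast
  then have "inv_into E f (2 *\<^sub>R z' - f z) = z"
    by (simp add: h_def scaleR_2 algebra_simps)
  moreover have "2 *\<^sub>R z' - f z \<in> f ` E"
    unfolding assms(2) using zE assms(2) subspace_E
    by (intro subspace_diff subspace_scale) auto
  ultimately have "2 *\<^sub>R z' - f z = f z" by (metis f_inv_into_f)
  then have "2 *\<^sub>R z' = 2 *\<^sub>R f z" by (simp add: scaleR_2 algebra_simps)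
  then show ?thesis by (simp add: z_def z'_def)
qed

text \<open>
  Preserving midpoints and \<open>0\<close> gives additivity. For homogeneity over the reals, \<open>k * r\<close> is within
  distance 1 of an integer, for which homogeneity is clear; so \<open>k\<close> times the defect of homogeneity at
  \<open>r\<close> stays bounded as \<open>k\<close> grows.
\<close>

proposition Mazur_Ulam:
  assumes "isometric f" "f ` E = E" "f 0 = 0" "x \<in> E" "y \<in> E"
  shows "f (x + y) = f x + f y" and "f (r *\<^sub>R x) = r *\<^sub>R f x"
proof -
  have zero: "0 \<in> E" using subspace_E by (rule subspace_0)
  have scale: "s *\<^sub>R v \<in> E" if "v \<in> E" for s v
    using subspace_E that by (rule subspace_scale)
  have double: "f (2 *\<^sub>R v) = 2 *\<^sub>R f v" if "v \<in> E" for v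
    using onto_isometry_midpoint[OF assms(1,2) scale[OF that, of 2] zero] assms(3) by simp
  have add: "f (v + w) = f v + f w" if "v \<in> E" "w \<in> E" for v w
    using onto_isometry_midpoint[OF assms(1,2) scale[OF that(1), of 2] scale[OF that(2), of 2]]
      double that by (simp add: scaleR_right_distrib)
  show "f (x + y) = f x + f y" using assms(4,5) by (rule add)
  have minus: "f (- v) = - f v" if "v \<in> E" for v
    using add[of v "- v"] that subspace_E assms(3) by (simp add: subspace_neg eq_neg_iff_add_eq_0 add.commute)
  have nat: "f (real n *\<^sub>R v) = real n *\<^sub>R f v" if "v \<in> E" for n v
    by (induction n) (use assms(3) that in \<open>simp_all add: add scale scaleR_left_distrib\<close>)
  have int: "f (real_of_int m *\<^sub>R v) = real_of_int m *\<^sub>R f v" if "v \<in> E" for m v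
  proof (cases m)
    case (nonneg n)
    then show ?thesis using nat[OF that] by simp
  next
    case (neg n)
    then show ?thesis
      using nat[OF that, of "Suc n"] minus[OF scale[OF that, of "real (Suc n)"]]
      by (simp del: of_nat_Suc)
  qed
  define d where "d = f (r *\<^sub>R x) - r *\<^sub>R f x"
  have bound: "real k * N d \<le> 2 * N x" for k :: nat
  proof -
    define s where "s = real k * r"
    define m where "m = \<lfloor>s\<rfloor>"
    have m: "\<bar>s - real_of_int m\<bar> \<le> 1" unfolding m_def by linarith
    have fx: "N (f x) = N x"
      using assms(1,3,4) zero unfolding isometric_def by (metis diff_zero)
    have "real k *\<^sub>R d = f (s *\<^sub>R x) - s *\<^sub>R f x"
      using nat[OF scale[OF assms(4), of r], of k] by (simp add: d_def s_def scaleR_right_diff_distrib)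
    also have "N \<dots> \<le> N (f (s *\<^sub>R x) - f (real_of_int m *\<^sub>R x)) + N (real_of_int m *\<^sub>R f x - s *\<^sub>R f x)"
      using N_triangle_diff int[OF assms(4)] by metis
    also have "N (f (s *\<^sub>R x) - f (real_of_int m *\<^sub>R x)) = N ((s - real_of_int m) *\<^sub>R x)"
      using assms(1) scale[OF assms(4)] by (simp add: isometric_def scaleR_left_diff_distrib)
    also have "\<dots> \<le> N x"
      using m N_nonneg[of x] by (simp add: N_scaleR mult_left_le_one_le)
    also have "N (real_of_int m *\<^sub>R f x - s *\<^sub>R f x) = \<bar>s - real_of_int m\<bar> * N x"
      using fx N_scaleR[of "real_of_int m - s" "f x"] by (simp add: scaleR_left_diff_distrib abs_minus_commute)
    also have "\<dots> \<le> N x" using m N_nonneg[of x] by (simp add: mult_left_le_one_le)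
    finally show ?thesis by (simp add: N_scaleR)
  qed
  have "N d = 0"
  proof (rule ccontr)
    assume "N d \<noteq> 0"
    then have "N d > 0" using N_nonneg[of d] by linarith
    moreover obtain k :: nat where "2 * N x / N d < real k" using reals_Archimedean2 by blast
    ultimately show False using bound[of k] by (simp add: field_simps)
  qed
  then show "f (r *\<^sub>R x) = r *\<^sub>R f x" using N_eq_0[of d] by (simp add: d_def)
qed

end

text \<open>
  In finite dimension \<open>N\<close> is equivalent to the Euclidean norm of the type class, so that convergence,
  compactness and continuity can be taken over from there.
\<close>

locale euclidean_normed_subspace = normed_subspace E N
  for E :: "'a::euclidean_space set" and N
begin

lemma N_le_norm: "\<exists>C>0. \<forall>x. N x \<le> C * norm x"
proof -
  define C where "C = (\<Sum>b\<in>Basis. N b)"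
  have N_sum: "N (\<Sum>b\<in>B. g b) \<le> (\<Sum>b\<in>B. N (g b))" if "finite B" for B :: "'a set" and g
    using that
  proof (induction rule: finite_induct)
    case (insert b B)
    then show ?case using N_triangle[of "g b" "\<Sum>b\<in>B. g b"] by simp
  qed simp
  have "N x \<le> C * norm x" for x
  proof -
    have "N x = N (\<Sum>b\<in>Basis. (x \<bullet> b) *\<^sub>R b)" by (simp add: euclidean_representation)
    also have "\<dots> \<le> (\<Sum>b\<in>Basis. N ((x \<bullet> b) *\<^sub>R b))" by (rule N_sum) simp
    also have "\<dots> \<le> (\<Sum>b\<in>Basis. norm x * N b)"
      by (intro sum_mono) (simp add: N_scaleR Basis_le_norm mult_right_mono)
    finally show ?thesis by (simp add: C_def sum_distrib_left mult.commute)
  qed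
  then have "N x \<le> (\<bar>C\<bar> + 1) * norm x" for x
    by (smt (verit) mult_right_mono norm_ge_zero)
  then show ?thesis by (intro exI[of _ "\<bar>C\<bar> + 1"]) auto
qed

lemma continuous_on_N: "continuous_on S N"
proof -
  obtain C where C: "C > 0" "\<And>x. N x \<le> C * norm x" using N_le_norm by blast
  have "\<bar>N x - N y\<bar> \<le> C * norm (x - y)" for x y
    using N_triangle[of "x - y" y] N_triangle[of "y - x" x] N_commute[of x y] C(2)[of "x - y"] by simp
  then have "C-lipschitz_on S N"
    using C(1) by (intro lipschitz_onI) (auto simp: dist_norm)
  then show ?thesis by (rule lipschitz_on_continuous_on)
qed

lemma norm_le_N: "\<exists>c>0. \<forall>x. norm x \<le> c * N x"
proof -
  have "sphere (0::'a) 1 \<noteq> {}" using vector_choose_size[of 1] by force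
  then obtain m :: 'a where m: "norm m = 1" "\<And>x. norm x = 1 \<Longrightarrow> N m \<le> N x"
    using continuous_attains_inf[OF compact_sphere _ continuous_on_N, of 0 1] by auto
  have pos: "N m > 0" using m(1) by (intro N_pos) auto
  have "norm x \<le> (1 / N m) * N x" for x
  proof (cases "x = 0")
    case False
    then have "N m \<le> N ((1 / norm x) *\<^sub>R x)" by (intro m(2)) simp
    then show ?thesis using pos False by (simp add: N_scaleR field_simps)
  qed simp
  then show ?thesis using pos by (intro exI[of _ "1 / N m"]) simp
qed

lemma tendsto_N_iff: "((\<lambda>k. N (f k)) \<longlongrightarrow> 0) F \<longleftrightarrow> (f \<longlongrightarrow> 0) F"
proof
  obtain c where c: "c > 0" "\<And>x. norm x \<le> c * N x" using norm_le_N by blast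
  assume "((\<lambda>k. N (f k)) \<longlongrightarrow> 0) F"
  then have "((\<lambda>k. c * N (f k)) \<longlongrightarrow> 0) F" by (rule tendsto_mult_right_zero)
  then show "(f \<longlongrightarrow> 0) F"
    by (rule Lim_null_comparison[rotated]) (simp add: c(2))
next
  obtain C where C: "C > 0" "\<And>x. N x \<le> C * norm x" using N_le_norm by blast
  assume "(f \<longlongrightarrow> 0) F"
  then have "((\<lambda>k. C * norm (f k)) \<longlongrightarrow> 0) F"
    by (intro tendsto_mult_right_zero tendsto_norm_zero)
  then show "((\<lambda>k. N (f k)) \<longlongrightarrow> 0) F"
    by (rule Lim_null_comparison[rotated]) (simp add: C(2))
qed

text \<open>
  Compare the orbit \<open>s n\<close> of a point \<open>y\<close> with itself: an isometry keeps \<open>s n\<close> and \<open>s (n + d)\<close> at the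
  distance between \<open>y\<close> and \<open>s d\<close>. By compactness the orbit has terms arbitrarily close to each
  other, so \<open>y\<close> is approximated by later terms of its own orbit. These lie in the image of a
  compact ball, which is closed.
\<close>

lemma isometric_onto:
  assumes "isometric f" "f 0 = 0"
  shows "f ` E = E"
proof
  show "f ` E \<subseteq> E" using assms(1) by (simp add: isometric_def)
  show "E \<subseteq> f ` E"
  proof
    fix y assume y: "y \<in> E"
    obtain C where C: "C > 0" "\<And>x. N x \<le> C * norm x" using N_le_norm by blast
    obtain c where c: "c > 0" "\<And>x. norm x \<le> c * N x" using norm_le_N by blast
    have zero: "0 \<in> E" using subspace_E by (rule subspace_0)
    have iso: "N (f u - f v) = N (u - v)" "f u \<in> E" if "u \<in> E" "v \<in> E" for u v
      using assms(1) that by (auto simp: isometric_def)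
    have fN: "N (f u) = N u" if "u \<in> E" for u
      using iso(1)[OF that zero] assms(2) by simp
    define K where "K = E \<inter> {x. N x \<le> N y}"
    have "closed K"
      unfolding K_def using subspace_E
      by (intro closed_Int closed_subspace closed_Collect_le continuous_on_N continuous_on_const)
    moreover have "bounded K"
      unfolding bounded_iff K_def
      by (intro exI[of _ "c * N y"]) (use c in \<open>auto intro!: order_trans[OF c(2)] mult_left_mono\<close>)
    ultimately have "compact K" by (simp add: compact_eq_bounded_closed)
    define s where "s n = (f ^^ n) y" for n
    have sK: "s n \<in> K" for n
      by (induction n) (use y iso(2) fN in \<open>auto simp: s_def K_def\<close>)
    have shift: "N (s n - s (n + d)) = N (y - s d)" for n d
    proof (induction n)
      case (Suc n)
      then show ?case using iso(1)[of "s n" "s (n + d)"] sK by (simp add: s_def K_def)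
    qed (simp add: s_def)
    have "continuous_on K f"
    proof (rule lipschitz_on_continuous_on)
      show "(c * C)-lipschitz_on K f"
      proof (rule lipschitz_onI)
        fix u v assume "u \<in> K" "v \<in> K"
        then have "norm (f u - f v) \<le> c * N (u - v)"
          using c(2)[of "f u - f v"] iso(1)[of u v] by (simp add: K_def)
        also have "\<dots> \<le> c * (C * norm (u - v))" using C(2) c(1) by (simp add: mult_left_mono)
        finally show "dist (f u) (f v) \<le> c * C * dist u v" by (simp add: dist_norm mult.assoc)
      qed (use c C in simp)
    qed
    then have closed: "closed (f ` K)"
      using \<open>compact K\<close> by (intro compact_imp_closed compact_continuous_image)
    obtain l r where r: "strict_mono r" "(s \<circ> r) \<longlonglongrightarrow> l"
      using \<open>compact K\<close> sK unfolding compact_eq_seq_compact_metric seq_compact_def by metis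
    define d where "d n = r (Suc n) - r n" for n
    have d: "d n > 0" for n
      using r(1) by (simp add: d_def strict_mono_Suc_iff)
    have "(\<lambda>n. (s \<circ> r) n - (s \<circ> r) (Suc n)) \<longlonglongrightarrow> l - l"
      by (intro tendsto_diff r(2) LIMSEQ_Suc)
    then have "(\<lambda>n. N (s (r n) - s (r (Suc n)))) \<longlonglongrightarrow> 0"
      by (simp add: tendsto_N_iff)
    moreover have "N (s (r n) - s (r (Suc n))) = N (y - s (d n))" for n
      using shift[of "r n" "d n"] d[of n] by (simp add: d_def)
    ultimately have "(\<lambda>n. y - s (d n)) \<longlonglongrightarrow> 0"
      by (simp add: tendsto_N_iff)
    then have "(\<lambda>n. y - (y - s (d n))) \<longlonglongrightarrow> y - 0" by (intro tendsto_diff tendsto_const)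
    then have lim: "(\<lambda>n. s (d n)) \<longlonglongrightarrow> y" by simp
    have "s (d n) \<in> f ` K" for n
      using d[of n] sK[of "d n - 1"] by (cases "d n") (auto simp: s_def)
    then have "y \<in> f ` K" using closed_sequentially[OF closed _ lim] by blast
    then show "y \<in> f ` E" by (auto simp: K_def)
  qed
qed

end

section \<open>Adjoints, unitary and scalar matrices\<close>

lemma conjg_scaleR: "conjg (r *\<^sub>R x) = r *\<^sub>R conjg (x :: 'f::real_or_complex)"
  by (simp add: scaleR_conv_of_real conjg_mult conjg_of_real)

lemma conjg_one: "conjg (1 :: 'f::real_or_complex) = 1"
  using conjg_of_real[of 1, where 'a='f] by simp

lemma linear_conjg: "linear (conjg :: 'f::real_or_complex \<Rightarrow> 'f)"
  by (intro linearI conjg_add conjg_scaleR)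

lemma linear_adj: "linear (adj :: 'f::real_or_complex^'n^'n \<Rightarrow> 'f^'n^'n)"
  by (intro linearI) (simp_all add: adj_def vec_eq_iff conjg_add conjg_scaleR)

lemmas adj_simps = linear_add[OF linear_adj] linear_diff[OF linear_adj]
  linear_neg[OF linear_adj] linear_cmul[OF linear_adj]

lemma adj_adj [simp]: "adj (adj a) = a"
  by (simp add: adj_def vec_eq_iff conjg_conjg)

lemma adj_mult: "adj (a ** b) = adj b ** adj a"
  by (simp add: adj_def vec_eq_iff matrix_matrix_mult_def linear_sum[OF linear_conjg] conjg_mult mult.commute)

lemma adj_mat: "adj (mat k) = mat (conjg k)"
  using linear_0[OF linear_conjg] by (auto simp: adj_def vec_eq_iff mat_def)

lemma adj_one [simp]: "adj (mat 1) = mat 1"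
  by (simp add: adj_mat conjg_one)

lemma bounded_linear_adj: "bounded_linear (adj :: 'f::real_or_complex^'n^'n \<Rightarrow> 'f^'n^'n)"
  using linear_adj by (simp add: linear_conv_bounded_linear)

lemma bounded_bilinear_matrix_mult:
  "bounded_bilinear ((**) :: 'f::real_or_complex^'n^'n \<Rightarrow> 'f^'n^'n \<Rightarrow> 'f^'n^'n)"
proof -
  have "bilinear ((**) :: 'f^'n^'n \<Rightarrow> 'f^'n^'n \<Rightarrow> 'f^'n^'n)"
    unfolding bilinear_def
    by (auto intro!: linearI simp: vec_eq_iff matrix_matrix_mult_def sum.distrib
        scaleR_sum_right distrib_left distrib_right)
  then show ?thesis by (simp add: bilinear_conv_bounded_bilinear)
qed

lemma mat_mult_entry: "(mat k ** a) $ i $ j = (k :: 'f::semiring_1) * a $ i $ j"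
proof -
  have "(mat k ** a) $ i $ j = (\<Sum>l\<in>UNIV. if l = i then k * a $ l $ j else 0)"
    unfolding matrix_matrix_mult_def mat_def vec_lambda_beta by (rule sum.cong) auto
  then show ?thesis by simp
qed

lemma mult_mat_entry: "(a ** mat k) $ i $ j = a $ i $ j * (k :: 'f::semiring_1)"
proof -
  have "(a ** mat k) $ i $ j = (\<Sum>l\<in>UNIV. if l = j then a $ i $ l * k else 0)"
    unfolding matrix_matrix_mult_def mat_def vec_lambda_beta by (rule sum.cong) auto
  then show ?thesis by simp
qed

lemma mat_mult_commute: "mat k ** a = a ** mat (k :: 'f::comm_semiring_1)"
  by (simp add: vec_eq_iff mat_mult_entry mult_mat_entry mult.commute)

lemma mat_of_real_mult: "mat (of_real r) ** a = r *\<^sub>R (a :: 'f::real_or_complex^'n^'n)"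
  by (simp add: vec_eq_iff mat_mult_entry) (simp add: scaleR_conv_of_real)

global_interpretation matmul: bounded_bilinear
  "(**) :: 'f::real_or_complex^'n^'n \<Rightarrow> 'f^'n^'n \<Rightarrow> 'f^'n^'n"
  by (rule bounded_bilinear_matrix_mult)

lemma norm_unitary:
  assumes "u \<in> unitary"
  shows "norm (u :: 'f::real_or_complex^'n^'n) = sqrt (real CARD('n))"
proof -
  have "norm (u $ i) = 1" for i
  proof -
    have "(u ** adj u) $ i $ i = 1" using assms by (simp add: unitary_def mat_def)
    then have "(of_real (\<Sum>j\<in>UNIV. (norm (u $ i $ j))\<^sup>2) :: 'f) = of_real 1"
      by (simp add: matrix_matrix_mult_def adj_def mult_conjg)
    then have "(\<Sum>j\<in>UNIV. (norm (u $ i $ j))\<^sup>2) = 1" by (simp only: of_real_eq_iff)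
    then show ?thesis by (simp add: norm_vec_def L2_set_def)
  qed
  then show ?thesis by (simp add: norm_vec_def[of u] L2_set_def)
qed

lemma unitary_mult:
  assumes "u \<in> unitary" "w \<in> unitary"
  shows "u ** w \<in> unitary"
proof -
  have "adj (u ** w) ** (u ** w) = adj w ** (adj u ** u) ** w"
    and "(u ** w) ** adj (u ** w) = u ** (w ** adj w) ** adj u"
    by (simp_all only: adj_mult matrix_mul_assoc)
  then show ?thesis using assms by (simp add: unitary_def)
qed

lemma unitary_limit:
  assumes "\<And>k. u k \<in> unitary" "u \<longlonglongrightarrow> (l :: 'f::real_or_complex^'n^'n)"
  shows "l \<in> unitary"
proof -
  have "(\<lambda>k. adj (u k)) \<longlonglongrightarrow> adj l"
    by (rule bounded_linear.tendsto[OF bounded_linear_adj assms(2)])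
  then have "(\<lambda>k. adj (u k) ** u k) \<longlonglongrightarrow> adj l ** l" "(\<lambda>k. u k ** adj (u k)) \<longlonglongrightarrow> l ** adj l"
    using assms(2) by (auto intro: matmul.tendsto)
  moreover have "adj (u k) ** u k = mat 1" "u k ** adj (u k) = mat 1" for k
    using assms(1)[of k] by (simp_all add: unitary_def)
  ultimately show ?thesis
    by (simp add: unitary_def LIMSEQ_const_iff)
qed

lemma bounded_linear_mat_entry: "bounded_linear (\<lambda>a :: 'f::real_or_complex^'n^'n. a $ i $ j)"
  using bounded_linear_compose[OF bounded_linear_vec_nth bounded_linear_vec_nth] .

section \<open>Limits of commutators and of unitary matrices\<close>

text \<open>
  The linear map sending \<open>y\<close> to the family of its commutators with the elements of \<open>X\<close> has closed
  range, although the \<open>y k\<close> themselves need not converge. Scalars do not contribute, so they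
  are first removed by making a diagonal entry vanish. After rescaling the sequence into the unit
  ball, a subsequence converges to some \<open>c\<close> while the scaling factors converge to some \<open>s\<close>. If \<open>s\<close>
  were \<open>0\<close>, then \<open>c\<close> would commute with \<open>X\<close> and hence be a scalar with a vanishing entry,
  contradicting that it has norm 1. So the rescaling can be undone in the limit.
\<close>

lemma commutator_limit:
  fixes X :: "('f::real_or_complex^'n^'n) set"
  assumes commutant: "\<And>y. (\<And>x. x \<in> X \<Longrightarrow> x ** y = y ** x) \<Longrightarrow> y \<in> range mat"
    and lim: "\<And>x. x \<in> X \<Longrightarrow> (\<lambda>k. x ** y k - y k ** x) \<longlonglongrightarrow> F x"
  shows "\<exists>b. \<forall>x\<in>X. F x = x ** b - b ** x"
proof -
  \<comment> \<open>Any index serves for normalizing a diagonal entry.\<close>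
  define \<iota> :: 'n where "\<iota> = undefined"
  define y' where "y' k = y k - mat (y k $ \<iota> $ \<iota>)" for k
  have y'_0: "y' k $ \<iota> $ \<iota> = 0" for k by (simp add: y'_def mat_def)
  have lim': "(\<lambda>k. x ** y' k - y' k ** x) \<longlonglongrightarrow> F x" if "x \<in> X" for x
    using lim[OF that] by (simp add: y'_def matmul.diff_left matmul.diff_right mat_mult_commute)
  \<comment> \<open>Dividing by \<open>1 + norm (y' k)\<close> handles bounded and unbounded sequences at once.\<close>
  define q where "q k = 1 / (1 + norm (y' k))" for k
  define z where "z k = q k *\<^sub>R y' k" for k
  have q: "0 < q k" "q k \<le> 1" for k
    by (simp_all add: q_def add_pos_nonneg)
  have qz: "norm (z k) = 1 - q k" for k
  proof -
    have "1 + norm (y' k) > 0" by (simp add: add_pos_nonneg)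
    then show ?thesis by (simp add: z_def q_def divide_simps)
  qed
  have "bounded (range (\<lambda>k. (q k, z k)))"
  proof (rule boundedI)
    fix p assume "p \<in> range (\<lambda>k. (q k, z k))"
    then obtain k where "p = (q k, z k)" by blast
    then show "norm p \<le> 2"
      using norm_Pair_le[of "q k" "z k"] q[of k] qz[of k] by simp
  qed
  then obtain p r where r: "strict_mono r" "((\<lambda>k. (q k, z k)) \<circ> r) \<longlonglongrightarrow> p"
    using bounded_imp_convergent_subsequence by blast
  obtain s c where p: "p = (s, c)" by (cases p)
  have ls: "(\<lambda>k. q (r k)) \<longlonglongrightarrow> s" and lc: "(\<lambda>k. z (r k)) \<longlonglongrightarrow> c"
    using tendsto_fst[OF r(2)] tendsto_snd[OF r(2)] by (simp_all add: p o_def)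
  have eq: "x ** c - c ** x = s *\<^sub>R F x" if "x \<in> X" for x
  proof (rule LIMSEQ_unique)
    show "(\<lambda>k. x ** z (r k) - z (r k) ** x) \<longlonglongrightarrow> x ** c - c ** x"
      by (intro tendsto_diff matmul.tendsto tendsto_const lc)
    have "(\<lambda>k. x ** y' (r k) - y' (r k) ** x) \<longlonglongrightarrow> F x"
      using LIMSEQ_subseq_LIMSEQ[OF lim'[OF that] r(1)] by (simp add: o_def)
    from tendsto_scaleR[OF ls this]
    show "(\<lambda>k. x ** z (r k) - z (r k) ** x) \<longlonglongrightarrow> s *\<^sub>R F x"
      by (simp add: z_def matmul.scaleR_left matmul.scaleR_right scaleR_right_diff_distrib)
  qed
  have "s \<noteq> 0"
  proof
    assume "s = 0"
    then have "c \<in> range mat" using eq by (intro commutant) simp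
    then obtain m where m: "c = mat m" by blast
    have "(\<lambda>k. z (r k) $ \<iota> $ \<iota>) \<longlonglongrightarrow> c $ \<iota> $ \<iota>"
      by (rule bounded_linear.tendsto[OF bounded_linear_mat_entry lc])
    then have "c $ \<iota> $ \<iota> = 0" by (simp add: z_def y'_0 LIMSEQ_const_iff)
    then have "c = 0" using m by (simp add: mat_def vec_eq_iff)
    have "(\<lambda>k. norm (z (r k))) \<longlonglongrightarrow> 1 - s"
      unfolding qz by (intro tendsto_diff tendsto_const ls)
    moreover have "(\<lambda>k. norm (z (r k))) \<longlonglongrightarrow> norm c" using lc by (rule tendsto_norm)
    ultimately have "1 - s = norm c" by (rule LIMSEQ_unique)
    with \<open>s = 0\<close> \<open>c = 0\<close> show False by simp
  qed
  then have "F x = x ** ((1 / s) *\<^sub>R c) - ((1 / s) *\<^sub>R c) ** x" if "x \<in> X" for x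
    using eq[OF that] by (simp add: matmul.scaleR_left matmul.scaleR_right
        scaleR_right_diff_distrib[symmetric])
  then show ?thesis by blast
qed

text \<open>
  Compatibility with adjoints says that \<open>b + adj b\<close> commutes with \<open>X\<close>, so it is a scalar. Therefore
  \<open>b\<close> differs from its skew part \<open>b'\<close> by a scalar only, and so does the result of removing the
  diagonal entry of \<open>b'\<close>, which is a skew scalar; scalars do not affect commutators.
\<close>

lemma skew_commutator:
  fixes X :: "('f::real_or_complex^'n^'n) set"
  assumes commutant: "\<And>y. (\<And>x. x \<in> X \<Longrightarrow> x ** y = y ** x) \<Longrightarrow> y \<in> range mat"
    and adj_X: "\<And>x. x \<in> X \<Longrightarrow> adj x \<in> X"
    and F: "\<And>x. x \<in> X \<Longrightarrow> F x = x ** b - b ** x"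
    and adj_F: "\<And>x. x \<in> X \<Longrightarrow> F (adj x) = adj (F x)"
  shows "\<exists>b\<in>skew0 \<iota>. \<forall>x\<in>X. F x = x ** b - b ** x"
proof -
  have "x ** (b + adj b) = (b + adj b) ** x" if "x \<in> X" for x
    using adj_F[OF adj_X[OF that]] F[OF that] F[OF adj_X[OF that]]
    by (simp add: adj_simps adj_mult matmul.add_left matmul.add_right algebra_simps)
  then obtain m where m: "b + adj b = mat m" using commutant by blast
  define b' where "b' = (1/2) *\<^sub>R (b - adj b)"
  have skew': "adj b' = - b'"
    by (simp add: b'_def adj_simps scaleR_right_diff_distrib)
  have b': "b' = b - mat (m / 2)"
  proof -
    have "b - adj b = 2 *\<^sub>R b - mat m" by (simp add: m[symmetric] scaleR_2)
    then have "b' = b - (1/2) *\<^sub>R mat m" by (simp add: b'_def scaleR_right_diff_distrib)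
    also have "(1/2) *\<^sub>R mat m = (mat (m / 2) :: 'f^'n^'n)"
      by (simp add: vec_eq_iff mat_def) (simp add: scaleR_conv_of_real)
    finally show ?thesis .
  qed
  define e where "e = b' $ \<iota> $ \<iota>"
  have "conjg e = - e" using arg_cong[OF skew', of "\<lambda>a. a $ \<iota> $ \<iota>"] by (simp add: adj_def e_def)
  then have "adj (mat e) = - (mat e :: 'f^'n^'n)" unfolding adj_mat by (simp add: vec_eq_iff mat_def)
  then have "b' - mat e \<in> skew0 \<iota>"
    by (simp add: skew0_def skew_def adj_simps skew') (simp add: e_def mat_def)
  moreover have "F x = x ** (b' - mat e) - (b' - mat e) ** x" if "x \<in> X" for x
    using F[OF that]
    by (simp add: b' matmul.diff_left matmul.diff_right mat_mult_commute)
  ultimately show ?thesis by blast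
qed

text \<open>
  The skew-hermitian matrices are the tangent space of the unitary group at the identity: a velocity
  of unitary matrices satisfies the equation obtained by differentiating \<open>adj v ** v = mat 1\<close>.
  The factors \<open>c k\<close> stand for the reciprocals of the times.
\<close>

lemma skew_derivative:
  fixes v :: "nat \<Rightarrow> 'f::real_or_complex^'n^'n"
  assumes "\<And>k. v k \<in> unitary" "v \<longlonglongrightarrow> mat 1"
    and "(\<lambda>k. c k *\<^sub>R (v k - mat 1)) \<longlonglongrightarrow> a"
  shows "a \<in> skew"
proof -
  have "(\<lambda>k. adj (c k *\<^sub>R (v k - mat 1)) ** v k + c k *\<^sub>R (v k - mat 1)) \<longlonglongrightarrow> adj a ** mat 1 + a"
    by (intro tendsto_add matmul.tendsto bounded_linear.tendsto[OF bounded_linear_adj] assms)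
  moreover have "adj (c k *\<^sub>R (v k - mat 1)) ** v k + c k *\<^sub>R (v k - mat 1) = 0" for k
    using assms(1)[of k]
    by (simp add: unitary_def adj_simps matmul.scaleR_left matmul.diff_left scaleR_right_diff_distrib)
  ultimately have "adj a + a = 0" by (simp add: LIMSEQ_const_iff)
  then show ?thesis by (simp add: skew_def eq_neg_iff_add_eq_0)
qed


section \<open>Derivatives of families of linear isometries\<close>

text \<open>
  The difference quotients of \<open>A k x = v w* \<gamma>(x) w\<close> are controlled in two steps. Largeness with
  respect to \<open>\<gamma>\<close> removes \<open>\<gamma>\<close>; then largeness with respect to the identity map, which says that \<open>X\<close>
  has only scalars in its commutant, makes it possible to pass to the limit in the conjugation by
  \<open>w\<close>, whose derivative is the commutator with a fixed matrix.
\<close>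

proposition derivative_of_isometries:
  fixes X :: "('f::real_or_complex^'n^'n) set"
  assumes "test_set \<Gamma>" "large \<Gamma> X" "isometry_property \<Gamma> X N"
    and adj_X: "\<And>x. x \<in> X \<Longrightarrow> adj x \<in> X"
    and A: "\<And>k. real_linear_isometry X N (A k)"
    and A_lim: "\<And>x. x \<in> X \<Longrightarrow> (\<lambda>k. A k x) \<longlonglongrightarrow> x"
    and A_deriv: "\<And>x. x \<in> X \<Longrightarrow> (\<lambda>k. c k *\<^sub>R (A k x - x)) \<longlonglongrightarrow> D x"
  shows "\<exists>a\<in>skew. \<exists>b\<in>skew0 \<iota>. \<forall>x\<in>X. D x = a ** x + x ** b"
proof -
  have one: "mat 1 \<in> X" using assms(2) by (simp add: large_def)
  have "\<forall>k. \<exists>u w \<gamma>. u \<in> unitary \<and> w \<in> unitary \<and> \<gamma> \<in> \<Gamma> \<and> (\<forall>x\<in>X. A k x = u ** \<gamma> x ** w)"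
    using assms(3) A unfolding isometry_property_def by metis
  then obtain u w g where uwg: "u k \<in> unitary" "w k \<in> unitary" "g k \<in> \<Gamma>"
    "\<And>x. x \<in> X \<Longrightarrow> A k x = u k ** g k x ** w k" for k by metis
  have "finite (range g)"
    using assms(1) uwg(3) by (auto simp: test_set_def intro: finite_subset)
  then obtain k0 where "infinite {k \<in> UNIV. g k = g k0}"
    using pigeonhole_infinite[of UNIV g] by auto
  then obtain p :: "nat \<Rightarrow> nat" where p: "strict_mono p" "\<And>k. g (p k) = g k0"
    using infinite_enumerate[of "{k \<in> UNIV. g k = g k0}"] by auto
  define \<gamma> where "\<gamma> = g k0"
  have "bounded (range (\<lambda>k. w (p k)))"
    by (intro boundedI[of _ "sqrt (real CARD('n))"]) (auto simp: norm_unitary uwg(2))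
  then obtain w0 q where q: "strict_mono q" "((\<lambda>k. w (p k)) \<circ> q) \<longlonglongrightarrow> w0"
    using bounded_imp_convergent_subsequence by blast
  define s where "s = p \<circ> q"
  have s: "strict_mono s" unfolding s_def using p(1) q(1) by (rule strict_mono_o)
  define w' where "w' k = w (s k)" for k
  define v where "v k = u (s k) ** w' k" for k
  have w'_unitary: "w' k \<in> unitary" for k by (simp add: w'_def uwg(2))
  have w'_lim: "w' \<longlonglongrightarrow> w0" using q(2) by (simp add: w'_def[abs_def] s_def o_def)
  have adj_w'_lim: "(\<lambda>k. adj (w' k)) \<longlonglongrightarrow> adj w0"
    using bounded_linear.tendsto[OF bounded_linear_adj w'_lim] .
  have w0: "w0 \<in> unitary" using unitary_limit[OF w'_unitary w'_lim] .
  have v_unitary: "v k \<in> unitary" for k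
    unfolding v_def by (intro unitary_mult w'_unitary uwg(1))
  have \<gamma>: "\<gamma> \<in> \<Gamma>" "\<gamma> (mat 1) = mat 1"
    using uwg(3)[of k0] assms(1) by (auto simp: \<gamma>_def test_set_def)
  have As: "A (s k) x = v k ** (adj (w' k) ** \<gamma> x ** w' k)" if "x \<in> X" for k x
  proof -
    have "v k ** (adj (w' k) ** \<gamma> x ** w' k) = u (s k) ** (w' k ** adj (w' k)) ** \<gamma> x ** w' k"
      by (simp only: v_def matrix_mul_assoc)
    also have "\<dots> = u (s k) ** \<gamma> x ** w' k"
      using w'_unitary[of k] by (simp add: unitary_def)
    finally show ?thesis
      using uwg(4)[OF that, of "s k"] p(2)[of "q k"] by (simp add: w'_def s_def \<gamma>_def)
  qed
  have A_one: "A (s k) (mat 1) = v k" for k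
    using As[OF one, of k] \<gamma>(2) w'_unitary[of k] by (simp add: unitary_def)
  have As_lim: "(\<lambda>k. A (s k) x) \<longlonglongrightarrow> x" if "x \<in> X" for x
    using LIMSEQ_subseq_LIMSEQ[OF A_lim[OF that] s] by (simp add: o_def)
  have As_deriv: "(\<lambda>k. c (s k) *\<^sub>R (A (s k) x - x)) \<longlonglongrightarrow> D x" if "x \<in> X" for x
    using LIMSEQ_subseq_LIMSEQ[OF A_deriv[OF that] s] by (simp add: o_def)
  have v_lim: "v \<longlonglongrightarrow> mat 1" using As_lim[OF one] by (simp add: A_one)
  have adj_v_lim: "(\<lambda>k. adj (v k)) \<longlonglongrightarrow> mat 1"
    using bounded_linear.tendsto[OF bounded_linear_adj v_lim] by simp

  \<comment> \<open>Taking limits and moving \<open>w0\<close> to the other side exhibits \<open>adj w0\<close> as an element of \<open>X\<^sup>\<gamma>\<close>.\<close>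
  have x_eq: "x = adj w0 ** \<gamma> x ** w0" if "x \<in> X" for x
  proof (rule LIMSEQ_unique[OF As_lim[OF that]])
    have "(\<lambda>k. v k ** (adj (w' k) ** \<gamma> x ** w' k)) \<longlonglongrightarrow> mat 1 ** (adj w0 ** \<gamma> x ** w0)"
      by (intro matmul.tendsto v_lim adj_w'_lim w'_lim tendsto_const)
    then show "(\<lambda>k. A (s k) x) \<longlonglongrightarrow> adj w0 ** \<gamma> x ** w0" by (simp add: As[OF that])
  qed
  have "x ** adj w0 = adj w0 ** \<gamma> x" if "x \<in> X" for x
  proof -
    have "x ** adj w0 = adj w0 ** \<gamma> x ** (w0 ** adj w0)"
      using x_eq[OF that] by (metis matrix_mul_assoc)
    then show ?thesis using w0 by (simp add: unitary_def)
  qed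
  then have "adj w0 \<in> twisted_commutant X \<gamma>" by (simp add: twisted_commutant_def)
  then have "adj w0 \<in> range mat" using assms(2) \<gamma>(1) unfolding large_def by blast
  then obtain m where m: "adj w0 = mat m" by blast
  have \<gamma>_id: "\<gamma> x = x" if "x \<in> X" for x
  proof -
    have "adj w0 ** \<gamma> x ** w0 = \<gamma> x ** (adj w0 ** w0)"
      by (simp add: m mat_mult_commute[of m "\<gamma> x"] matrix_mul_assoc)
    then show ?thesis using x_eq[OF that] w0 by (simp add: unitary_def)
  qed

  have commutant: "y \<in> range mat" if "\<And>x. x \<in> X \<Longrightarrow> x ** y = y ** x" for y
  proof -
    have "y \<in> twisted_commutant X id" using that by (simp add: twisted_commutant_def)
    then show ?thesis using assms(1,2) unfolding large_def test_set_def by blast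
  qed

  \<comment> \<open>\<open>a0\<close> is the velocity of \<open>v\<close>, and \<open>F\<close> that of the conjugation by \<open>w\<close>, with quotients \<open>B k\<close>.\<close>
  define a0 where "a0 = D (mat 1)"
  define F where "F x = D x - a0 ** x" for x
  define B where "B k x = c (s k) *\<^sub>R (adj (w' k) ** x ** w' k - x)" for k x
  have a0: "(\<lambda>k. c (s k) *\<^sub>R (v k - mat 1)) \<longlonglongrightarrow> a0"
    using As_deriv[OF one] by (simp add: A_one a0_def)
  have a0_skew: "a0 \<in> skew" using skew_derivative[OF v_unitary v_lim a0] .
  have B_lim: "(\<lambda>k. B k x) \<longlonglongrightarrow> F x" if "x \<in> X" for x
  proof -
    have "B k x = adj (v k) **
        (c (s k) *\<^sub>R (A (s k) x - x) - (c (s k) *\<^sub>R (v k - mat 1)) ** x)" for k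
    proof -
      have "A (s k) x = v k ** (adj (w' k) ** x ** w' k)"
        using As[OF that] \<gamma>_id[OF that] by simp
      then have "c (s k) *\<^sub>R (A (s k) x - x) - (c (s k) *\<^sub>R (v k - mat 1)) ** x = v k ** B k x"
        by (simp add: B_def matmul.scaleR_left matmul.scaleR_right matmul.diff_left
            matmul.diff_right scaleR_right_diff_distrib)
      moreover have "adj (v k) ** (v k ** B k x) = B k x"
        using v_unitary[of k] by (simp add: matrix_mul_assoc unitary_def)
      ultimately show ?thesis by simp
    qed
    moreover have "(\<lambda>k. adj (v k) **
        (c (s k) *\<^sub>R (A (s k) x - x) - (c (s k) *\<^sub>R (v k - mat 1)) ** x)) \<longlonglongrightarrow> mat 1 ** (D x - a0 ** x)"
      by (intro matmul.tendsto tendsto_diff adj_v_lim As_deriv[OF that] a0 tendsto_const)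
    ultimately show ?thesis by (simp add: F_def)
  qed
  \<comment> \<open>Multiplying \<open>B k x\<close> by \<open>w\<close> turns the conjugation into a commutator.\<close>
  have "(\<lambda>k. x ** (c (s k) *\<^sub>R w' k) - (c (s k) *\<^sub>R w' k) ** x) \<longlonglongrightarrow> w0 ** F x" if "x \<in> X" for x
  proof -
    have "w' k ** B k x = x ** (c (s k) *\<^sub>R w' k) - (c (s k) *\<^sub>R w' k) ** x" for k
    proof -
      have "w' k ** (adj (w' k) ** x ** w' k) = x ** w' k"
        using w'_unitary[of k] by (simp add: matrix_mul_assoc unitary_def)
      then show ?thesis
        by (simp add: B_def matmul.scaleR_left matmul.scaleR_right matmul.diff_right
            scaleR_right_diff_distrib)
    qed
    moreover have "(\<lambda>k. w' k ** B k x) \<longlonglongrightarrow> w0 ** F x"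
      by (intro matmul.tendsto w'_lim B_lim[OF that])
    ultimately show ?thesis by simp
  qed
  from commutator_limit[OF commutant this]
  obtain y where y: "\<And>x. x \<in> X \<Longrightarrow> w0 ** F x = x ** y - y ** x" by blast
  \<comment> \<open>The factor \<open>w0\<close> can be moved past \<open>x\<close> because it is scalar.\<close>
  have F: "F x = x ** (adj w0 ** y) - (adj w0 ** y) ** x" if "x \<in> X" for x
  proof -
    have "F x = adj w0 ** (w0 ** F x)" using w0 by (simp add: matrix_mul_assoc unitary_def)
    also have "\<dots> = adj w0 ** x ** y - adj w0 ** y ** x"
      by (simp add: y[OF that] matmul.diff_right matrix_mul_assoc)
    also have "adj w0 ** x = x ** adj w0" by (simp add: m mat_mult_commute)
    finally show ?thesis by (simp add: matrix_mul_assoc)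
  qed
  \<comment> \<open>Conjugation by a unitary matrix commutes with taking adjoints, hence so does its velocity.\<close>
  have adj_F: "F (adj x) = adj (F x)" if "x \<in> X" for x
  proof (rule LIMSEQ_unique[OF B_lim[OF adj_X[OF that]]])
    have "B k (adj x) = adj (B k x)" for k
      by (simp add: B_def adj_simps adj_mult matrix_mul_assoc)
    then show "(\<lambda>k. B k (adj x)) \<longlonglongrightarrow> adj (F x)"
      using bounded_linear.tendsto[OF bounded_linear_adj B_lim[OF that]] by simp
  qed
  from skew_commutator[OF commutant adj_X F adj_F]
  obtain b where b: "b \<in> skew0 \<iota>" "\<And>x. x \<in> X \<Longrightarrow> F x = x ** b - b ** x" by blast
  have "D x = (a0 - b) ** x + x ** b" if "x \<in> X" for x
    using b(2)[OF that] by (simp add: F_def matmul.diff_left algebra_simps)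
  moreover have "a0 - b \<in> skew"
    using a0_skew b(1) by (simp add: skew0_def skew_def adj_simps)
  ultimately show ?thesis using b(1) by blast
qed

section \<open>Infinitesimal rigid motions\<close>

lemma euclidean_normed_subspace_matrix:
  assumes "subspace X" "matrix_norm N"
  shows "euclidean_normed_subspace X (N :: 'f::real_or_complex^'n^'n \<Rightarrow> real)"
proof
  show "N (r *\<^sub>R x) = \<bar>r\<bar> * N x" for r x
    using assms(2) unfolding matrix_norm_def by (metis mat_of_real_mult norm_of_real)
qed (use assms in \<open>auto simp: matrix_norm_def\<close>)

lemma rigid_motion_linear_isometry:
  fixes X :: "('f::real_or_complex^'n^'n) set"
  assumes "euclidean_normed_subspace X N" "rigid_motion X N \<alpha>" "t \<in> {-1..1}"
  shows "real_linear_isometry X N (\<lambda>x. \<alpha> x t - \<alpha> 0 t)"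
proof -
  interpret euclidean_normed_subspace X N by fact
  define f where "f x = \<alpha> x t - \<alpha> 0 t" for x
  have zero: "0 \<in> X" using subspace_E by (rule subspace_0)
  have \<alpha>: "\<alpha> x t \<in> X" if "x \<in> X" for x
    using assms(2,3) that unfolding rigid_motion_def N_path_def by blast
  have "N (\<alpha> x t - \<alpha> y t) = N (x - y)" if "x \<in> X" "y \<in> X" for x y
    using assms(2,3) that unfolding rigid_motion_def by blast
  then have iso: "isometric f"
    using \<alpha> zero subspace_E by (auto simp: isometric_def f_def subspace_diff)
  have f0: "f 0 = 0" by (simp add: f_def)
  note onto = isometric_onto[OF iso f0]
  have Nf: "N (f x) = N x" if "x \<in> X" for x
    using iso f0 zero that unfolding isometric_def by (metis diff_zero)
  have "real_linear_isometry X N f"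
    unfolding real_linear_isometry_def
    using Mazur_Ulam[OF iso onto f0] onto Nf by blast
  then show ?thesis by (simp add: f_def[abs_def])
qed

theorem theorem2p13:
  fixes N :: "'f::real_or_complex^'n^'n \<Rightarrow> real"
    and X :: "('f^'n^'n) set"
    and \<iota> :: 'n
    and \<eta> :: "'f^'n^'n \<Rightarrow> 'f^'n^'n"
  assumes "CARD('n) \<ge> 2"
    and "unitarily_invariant_norm N"
    and "admissible \<iota> X N"
    and "\<eta> \<in> infinitesimal_rigid_motions X N"
  shows "\<exists>!abc. case abc of (a, b, c) \<Rightarrow>
           a \<in> skew \<and> b \<in> skew0 \<iota> \<and> c \<in> X \<and> (\<forall>x\<in>X. \<eta> x = a ** x + x ** b + c)"
proof -
  obtain \<Gamma> where \<Gamma>: "test_set \<Gamma>" "large \<Gamma> X" "isometry_property \<Gamma> X N"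
    and X: "subspace X" and adj_X: "\<And>x. x \<in> X \<Longrightarrow> adj x \<in> X"
    using assms(3) unfolding admissible_def by blast
  interpret euclidean_normed_subspace X N
    using X assms(2) by (intro euclidean_normed_subspace_matrix) (simp_all add: unitarily_invariant_norm_def)
  obtain \<alpha> where \<alpha>: "rigid_motion X N \<alpha>"
    and \<eta>: "\<And>x. x \<in> X \<Longrightarrow> \<eta> x \<in> X \<and> has_N_derivative_at_0 N (\<alpha> x) (\<eta> x)"
    using assms(4) unfolding infinitesimal_rigid_motions_def by blast
  have \<alpha>_0: "\<alpha> x 0 = x" if "x \<in> X" for x using \<alpha> that unfolding rigid_motion_def by blast
  have zero: "0 \<in> X" using X by (rule subspace_0)
  have one: "mat 1 \<in> X" using \<Gamma>(2) by (simp add: large_def)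

  \<comment> \<open>It suffices to look at the motion along one sequence of times tending to \<open>0\<close>.\<close>
  define t where "t k = inverse (real (Suc k))" for k
  have t: "t k \<in> {-1..1}" "t k \<noteq> 0" for k
    by (auto simp: t_def field_simps)
  have t_lim: "t \<longlonglongrightarrow> 0"
    unfolding t_def by (rule LIMSEQ_inverse_real_of_nat)
  define A where "A k x = \<alpha> x (t k) - \<alpha> 0 (t k)" for k x
  have A: "real_linear_isometry X N (A k)" for k
    unfolding A_def
    using rigid_motion_linear_isometry[OF euclidean_normed_subspace_axioms \<alpha> t(1)] .
  have deriv: "(\<lambda>k. inverse (t k) *\<^sub>R (\<alpha> x (t k) - x)) \<longlonglongrightarrow> \<eta> x" if "x \<in> X" for x
  proof -
    have "((\<lambda>s. (1 / s) *\<^sub>R (\<alpha> x s - x) - \<eta> x) \<longlongrightarrow> 0) (at 0)"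
      using \<eta>[OF that] by (simp add: has_N_derivative_at_0_def tendsto_N_iff \<alpha>_0[OF that])
    then have "((\<lambda>s. (1 / s) *\<^sub>R (\<alpha> x s - x)) \<longlongrightarrow> \<eta> x) (at 0)"
      by (simp add: LIM_zero_iff)
    moreover have "filterlim t (at 0) sequentially"
      using t_lim t(2) by (simp add: filterlim_at)
    ultimately show ?thesis
      using filterlim_compose[of "\<lambda>s. (1 / s) *\<^sub>R (\<alpha> x s - x)" _ _ t] by (simp add: divide_inverse)
  qed
  have A_deriv: "(\<lambda>k. inverse (t k) *\<^sub>R (A k x - x)) \<longlonglongrightarrow> \<eta> x - \<eta> 0" if "x \<in> X" for x
    using tendsto_diff[OF deriv[OF that] deriv[OF zero]]
    by (simp add: A_def scaleR_right_diff_distrib algebra_simps)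
  have A_lim: "(\<lambda>k. A k x) \<longlonglongrightarrow> x" if "x \<in> X" for x
  proof -
    have "(\<lambda>k. t k *\<^sub>R (inverse (t k) *\<^sub>R (A k x - x)) + x) \<longlonglongrightarrow> 0 *\<^sub>R (\<eta> x - \<eta> 0) + x"
      by (intro tendsto_add tendsto_scaleR t_lim A_deriv[OF that] tendsto_const)
    then show ?thesis using t(2) by simp
  qed
  obtain a b where ab: "a \<in> skew" "b \<in> skew0 \<iota>"
    and eq: "\<And>x. x \<in> X \<Longrightarrow> \<eta> x - \<eta> 0 = a ** x + x ** b"
    using derivative_of_isometries[OF \<Gamma> adj_X A A_lim A_deriv] by metis
  have \<eta>_eq: "\<eta> x = a ** x + x ** b + \<eta> 0" if "x \<in> X" for x
    using eq[OF that] by (simp add: algebra_simps)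

  show ?thesis
  proof (rule ex1I[of _ "(a, b, \<eta> 0)"], goal_cases)
    case 1
    show ?case using ab \<eta>_eq \<eta>[OF zero] by simp
  next
    case (2 abc)
    obtain a' b' c' where abc: "abc = (a', b', c')" by (cases abc)
    have b': "b' \<in> skew0 \<iota>" and \<eta>': "\<And>x. x \<in> X \<Longrightarrow> \<eta> x = a' ** x + x ** b' + c'"
      using 2 by (auto simp: abc)
    have c': "c' = \<eta> 0" using \<eta>'[OF zero] by simp
    have same: "a' ** x + x ** b' = a ** x + x ** b" if "x \<in> X" for x
      using \<eta>'[OF that] \<eta>_eq[OF that] by (simp add: c')
    have a': "a' - a = b - b'" using same[OF one] by (simp add: algebra_simps)
    have "x ** (b - b') = (b - b') ** x" if "x \<in> X" for x
    proof -
      have "(a' - a) ** x = x ** (b - b')"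
        using same[OF that] by (simp add: matmul.diff_left matmul.diff_right algebra_simps)
      then show ?thesis by (simp add: a')
    qed
    then have "b - b' \<in> twisted_commutant X id" by (simp add: twisted_commutant_def)
    then have "b - b' \<in> range mat" using \<Gamma>(1,2) unfolding large_def test_set_def by blast
    then obtain m where m: "b - b' = mat m" by blast
    have "m = (b - b') $ \<iota> $ \<iota>" by (simp add: m mat_def)
    then have "m = 0" using ab(2) b' by (simp add: skew0_def)
    then have "b' = b" using m by (simp add: mat_def vec_eq_iff)
    then show ?case using a' c' abc by simp
  qed
qed

end
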